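(* Let $x=x(s)$ be a regular curve in $\mathbb{E}^3$, parametrized by arclength $s$, with nonzero Frenet curvatures $\kappa_1$ and $\kappa_2$. Then the Frenet curvatures $\widetilde{\kappa}_1$ and $\widetilde{\kappa}_2$ of the (generalized) evolute $\widetilde{x}$ of $x$ are given by $$\widetilde{\kappa}_1=\frac{\kappa_2^2}{\left|\rho\kappa_2^2+\rho'\right|},\qquad \widetilde{\kappa}_2=\frac{\kappa_1\kappa_2}{\left|\rho\kappa_2^2+\rho'\right|},$$ where $\rho=\frac{1}{\kappa_1}$ is the radius of curvature of $x$.
   Context: Primes denote $d/ds$. For a curve $y$ in $\mathbb{E}^3$ with speed $v=\|y'\|$, the Frenet frame is an orthonormal frame $T=y'/\|y'\|,N_1,N_2$ along $y$, and the Frenet curvatures are functions $\kappa_1,\kappa_2$, with $T'=v\kappa_1N_1$, $N_1'=v(-\kappa_1T+\kappa_2N_2)$, $N_2'=-v\kappa_2N_1$. The generalized evolute (focal curve) of $x$ is the curve of centers of the osculating spheres of $x$, $\widetilde{x}=x+c_1N_1+c_2N_2$ with $c_1=\rho=1/\kappa_1$ and $c_2=\rho'/\kappa_2$.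
   Formalization: The printed denominator |ρκ2²+ρ'| is false in general and is corrected to |ρκ2²+κ2(ρ'/κ2)'|; the evolute is assumed regular, and, as frames are unoriented, the curvatures of an arbitrary Frenet frame of it are determined up to constant signs. *)

theory Defs
  imports "HOL-Analysis.Analysis"
begin

definition regular_curve_on :: "real set \<Rightarrow> (real \<Rightarrow> real^3) \<Rightarrow> bool" where
  "regular_curve_on I y \<longleftrightarrow>
     (\<forall>s\<in>I. y differentiable (at s) \<and> vector_derivative y (at s) \<noteq> 0)"

definition speed :: "(real \<Rightarrow> real^3) \<Rightarrow> real \<Rightarrow> real" where
  "speed y s = norm (vector_derivative y (at s))"

definition arclength_parametrized_on :: "real set \<Rightarrow> (real \<Rightarrow> real^3) \<Rightarrow> bool" where
  "arclength_parametrized_on I y \<longleftrightarrow> (\<forall>s\<in>I. y differentiable (at s) \<and> speed y s = 1)"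

definition orthonormal_frame :: "real^3 \<Rightarrow> real^3 \<Rightarrow> real^3 \<Rightarrow> bool" where
  "orthonormal_frame a b c \<longleftrightarrow>
     norm a = 1 \<and> norm b = 1 \<and> norm c = 1 \<and> a \<bullet> b = 0 \<and> a \<bullet> c = 0 \<and> b \<bullet> c = 0"

text \<open>
  The frame is not required to be positively oriented, and the curvatures are not required to be
  positive. Replacing \<open>N1\<close> or \<open>N2\<close> by its negative therefore gives another Frenet frame of the
  same curve, in which \<open>\<kappa>1\<close> or \<open>\<kappa>2\<close> (or both) have changed sign.
\<close>

definition frenet_frame_on ::
  "real set \<Rightarrow> (real \<Rightarrow> real^3) \<Rightarrow> (real \<Rightarrow> real^3) \<Rightarrow> (real \<Rightarrow> real^3) \<Rightarrow> (real \<Rightarrow> real^3) \<Rightarrow>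
   (real \<Rightarrow> real) \<Rightarrow> (real \<Rightarrow> real) \<Rightarrow> bool" where
  "frenet_frame_on I y T N1 N2 \<kappa>1 \<kappa>2 \<longleftrightarrow> regular_curve_on I y \<and>
     (\<forall>s\<in>I.
        orthonormal_frame (T s) (N1 s) (N2 s) \<and>
        T s = vector_derivative y (at s) /\<^sub>R speed y s \<and>
        (T has_vector_derivative (speed y s * \<kappa>1 s) *\<^sub>R N1 s) (at s) \<and>
        (N1 has_vector_derivative
           speed y s *\<^sub>R (- \<kappa>1 s *\<^sub>R T s + \<kappa>2 s *\<^sub>R N2 s)) (at s) \<and>
        (N2 has_vector_derivative - (speed y s * \<kappa>2 s) *\<^sub>R N1 s) (at s))"

definition curvature_radius :: "(real \<Rightarrow> real) \<Rightarrow> real \<Rightarrow> real" where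
  "curvature_radius \<kappa>1 s = 1 / \<kappa>1 s"

text \<open>
  The centre of the osculating sphere, for a curve parametrized by arclength.
\<close>

definition evolute ::
  "(real \<Rightarrow> real^3) \<Rightarrow> (real \<Rightarrow> real^3) \<Rightarrow> (real \<Rightarrow> real^3) \<Rightarrow>
   (real \<Rightarrow> real) \<Rightarrow> (real \<Rightarrow> real) \<Rightarrow> real \<Rightarrow> real^3" where
  "evolute x N1 N2 \<kappa>1 \<kappa>2 s =
     x s + curvature_radius \<kappa>1 s *\<^sub>R N1 s
         + (deriv (curvature_radius \<kappa>1) s / \<kappa>2 s) *\<^sub>R N2 s"

text \<open>
  By the Frenet equations the velocity of the evolute is
  \<open>(\<rho> * \<kappa>2 + (\<rho>' / \<kappa>2)') *\<^sub>R N2\<close>. Hence the denominator in the formulas for its curvatures is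
  the absolute value of \<open>\<rho> * \<kappa>2\<^sup>2 + \<kappa>2 * (\<rho>' / \<kappa>2)'\<close>. The source prints \<open>\<rho> * \<kappa>2\<^sup>2 + \<rho>'\<close>
  instead. That is a misprint: it disagrees with this velocity and is not homogeneous under scaling
  of the curve (\<open>\<rho>'\<close> is scale invariant, whereas \<open>\<rho> * \<kappa>2\<^sup>2\<close> scales like an inverse length).
\<close>

end

theory Submission
  imports Defs
begin

text \<open>
  Writing \<open>c = \<rho>' / \<kappa>2\<close>, the evolute has velocity \<open>g *\<^sub>R N2\<close> with \<open>g = \<rho> * \<kappa>2 + c'\<close>, so up to signs
  \<open>(N2, N1, T)\<close> is a Frenet frame of the evolute. Neither \<open>g\<close> nor \<open>\<kappa>2\<close> need be continuous, but
  both are coefficients of a derivative along a continuous unit field, so by Darboux's theorem their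
  signs are constant on \<open>I\<close>. Any other Frenet frame differs from this one by continuous, hence
  constant, signs.
\<close>

section \<open>Constancy of sign for derivatives and velocity coefficients\<close>

lemma Darboux_no_sign_change:
  fixes h h' :: "real \<Rightarrow> real"
  assumes "a < b"
    and der: "\<And>t. t \<in> {a..b} \<Longrightarrow> (h has_real_derivative h' t) (at t)"
    and nz: "\<And>t. t \<in> {a..b} \<Longrightarrow> h' t \<noteq> 0"
    and neg: "h' a < 0"
  shows "h' b < 0"
proof (rule ccontr)
  assume "\<not> h' b < 0"
  then have pos: "h' b > 0"
    using nz[of b] \<open>a < b\<close> by fastforce
  have "continuous_on {a..b} h"
    using der DERIV_isCont continuous_at_imp_continuous_on by blast
  then obtain c where c: "c \<in> {a..b}" and min: "\<And>t. t \<in> {a..b} \<Longrightarrow> h c \<le> h t"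
    using continuous_attains_inf[of "{a..b}" h] \<open>a < b\<close> by auto
  have "c \<noteq> a"
  proof
    assume "c = a"
    have "(h has_real_derivative h' a) (at a)"
      using der[of a] \<open>a < b\<close> by auto
    from DERIV_neg_dec_right[OF this neg] obtain d where
      d: "d > 0" "\<And>e. 0 < e \<Longrightarrow> e < d \<Longrightarrow> h (a + e) < h a"
      by auto
    \<comment> \<open>Half of \<open>d\<close> stays strictly inside the range of decrease; the
      bound \<open>b - a\<close> keeps \<open>a + e\<close> in the interval.\<close>
    define e where "e = min (d / 2) (b - a)"
    have "0 < e" "e < d" "a + e \<in> {a..b}"
      using d(1) \<open>a < b\<close> by (auto simp: e_def min_def)
    then show False
      using d(2)[of e] min[of "a + e"] \<open>c = a\<close> by auto
  qed
  moreover have "c \<noteq> b"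
  proof
    assume "c = b"
    have "(h has_real_derivative h' b) (at b)"
      using der[of b] \<open>a < b\<close> by auto
    from DERIV_pos_inc_left[OF this pos] obtain d where
      d: "d > 0" "\<And>e. 0 < e \<Longrightarrow> e < d \<Longrightarrow> h (b - e) < h b"
      by auto
    define e where "e = min (d / 2) (b - a)"
    have "0 < e" "e < d" "b - e \<in> {a..b}"
      using d(1) \<open>a < b\<close> by (auto simp: e_def min_def)
    then show False
      using d(2)[of e] min[of "b - e"] \<open>c = b\<close> by auto
  qed
  ultimately have ab: "a < c" "c < b"
    using c by auto
  have "h' c = 0"
  proof (rule DERIV_local_min)
    show "(h has_real_derivative h' c) (at c)"
      using der c by auto
    show "0 < min (c - a) (b - c)"
      using ab by auto
    show "\<forall>y. \<bar>c - y\<bar> < min (c - a) (b - c) \<longrightarrow> h c \<le> h y"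
      by (auto intro!: min)
  qed
  then show False
    using nz c by blast
qed

text \<open>For ordered points the negative case is the previous lemma for \<open>h\<close>, the
  positive case is the same lemma for \<open>- h\<close>; the claim is symmetric in \<open>a\<close>
  and \<open>b\<close>.\<close>

lemma Darboux_sgn_eq:
  fixes h h' :: "real \<Rightarrow> real"
  assumes "is_interval J" "a \<in> J" "b \<in> J"
    and der: "\<And>t. t \<in> J \<Longrightarrow> (h has_real_derivative h' t) (at t)"
    and nz: "\<And>t. t \<in> J \<Longrightarrow> h' t \<noteq> 0"
  shows "sgn (h' a) = sgn (h' b)"
proof -
  have *: "sgn (h' p) = sgn (h' q)" if "p \<in> J" "q \<in> J" "p < q" for p q
  proof -
    have sub: "t \<in> J" if "t \<in> {p..q}" for t
      using mem_is_interval_1_I[OF \<open>is_interval J\<close> \<open>p \<in> J\<close> \<open>q \<in> J\<close>] that by auto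
    have "h' q < 0" if "h' p < 0"
      using \<open>p < q\<close> by (rule Darboux_no_sign_change[OF _ der nz that]) (simp_all add: sub)
    moreover have "- h' q < 0" if "- h' p < 0"
      using \<open>p < q\<close>
      by (rule Darboux_no_sign_change[where h = "\<lambda>t. - h t" and a = p
            and h' = "\<lambda>t. - h' t", OF _ _ _ that])
        (auto intro!: DERIV_minus der simp: nz sub)
    ultimately show ?thesis
      using nz[OF \<open>p \<in> J\<close>] by (auto simp: sgn_if)
  qed
  show ?thesis
    using * assms(2,3) by (metis linorder_less_linear)
qed

text \<open>Near a point \<open>s\<close> the factor \<open>n t \<bullet> n s\<close> is positive by
  continuity, so \<open>g\<close> has there the sign of the derivative of a scalar function, and
  Darboux makes that sign locally constant. Connectedness of \<open>I\<close> makes it globally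
  constant.\<close>

lemma velocity_coefficient_sgn_eq:
  fixes y n :: "real \<Rightarrow> 'a::real_inner" and g :: "real \<Rightarrow> real"
  assumes "open I" "is_interval I"
    and der: "\<And>s. s \<in> I \<Longrightarrow> (y has_vector_derivative g s *\<^sub>R n s) (at s)"
    and cont: "continuous_on I n"
    and n0: "\<And>s. s \<in> I \<Longrightarrow> n s \<noteq> 0"
    and g0: "\<And>s. s \<in> I \<Longrightarrow> g s \<noteq> 0"
    and "a \<in> I" "b \<in> I"
  shows "sgn (g a) = sgn (g b)"
proof (rule connected_local_const[where A = I and f = "\<lambda>s. sgn (g s)"])
  show "connected I"
    using assms(2) is_interval_connected by blast
  show "\<forall>s\<in>I. eventually (\<lambda>t. sgn (g s) = sgn (g t)) (at s within I)"
  proof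
    fix s assume s: "s \<in> I"
    have "open (I \<inter> (\<lambda>t. n t \<bullet> n s) -` {0<..})"
      using cont \<open>open I\<close>
      by (intro continuous_open_preimage continuous_on_inner continuous_on_const) auto
    also have "I \<inter> (\<lambda>t. n t \<bullet> n s) -` {0<..} = {t \<in> I. 0 < n t \<bullet> n s}"
      by auto
    finally have "open {t \<in> I. 0 < n t \<bullet> n s}" .
    moreover have "s \<in> {t \<in> I. 0 < n t \<bullet> n s}"
      using s n0 by simp
    ultimately obtain e where "e > 0" and e: "ball s e \<subseteq> {t \<in> I. 0 < n t \<bullet> n s}"
      by (metis open_contains_ball)
    have "sgn (g s) = sgn (g t)" if t: "t \<in> ball s e" for t
    proof -
      \<comment> \<open>The vector \<open>n s\<close> is frozen, so only \<open>y\<close> is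
        differentiated and continuity of \<open>n\<close> suffices.\<close>
      have "sgn (g s * (n s \<bullet> n s)) = sgn (g t * (n t \<bullet> n s))"
      proof (rule Darboux_sgn_eq[where J = "ball s e" and a = s and b = t
            and h = "\<lambda>t. y t \<bullet> n s" and h' = "\<lambda>t. g t * (n t \<bullet> n s)"])
        show "is_interval (ball s e)"
          by (simp add: is_interval_ball_real)
        fix u assume u: "u \<in> ball s e"
        have "((\<lambda>t. y t \<bullet> n s) has_vector_derivative (g u *\<^sub>R n u) \<bullet> n s) (at u)"
          using der e u
          by (intro bounded_linear.has_vector_derivative[OF bounded_linear_inner_left]) auto
        then show "((\<lambda>t. y t \<bullet> n s) has_real_derivative g u * (n u \<bullet> n s)) (at u)"
          by (simp add: has_real_derivative_iff_has_vector_derivative)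
        show "g u * (n u \<bullet> n s) \<noteq> 0"
          using e u g0 by fastforce
      qed (use t \<open>e > 0\<close> in auto)
      moreover have "n s \<bullet> n s > 0" "n t \<bullet> n s > 0"
        using e t \<open>e > 0\<close> by (auto simp: subset_eq)
      ultimately show ?thesis
        by (simp add: sgn_mult)
    qed
    then show "eventually (\<lambda>t. sgn (g s) = sgn (g t)) (at s within I)"
      using \<open>e > 0\<close> unfolding eventually_at
      by (auto simp: dist_commute)
  qed
  show "a \<in> I" "b \<in> I"
    by fact+
qed

section \<open>Uniqueness of Frenet frames up to constant signs\<close>

text \<open>A continuous function with finite range on a connected set is constant. On the empty set
  the sign is arbitrary and 1 is taken.\<close>

lemma continuous_sign_constant:
  fixes f :: "'a::topological_space \<Rightarrow> real"
  assumes "connected S" "continuous_on S f" and f: "\<And>s. s \<in> S \<Longrightarrow> f s \<in> {1, -1}"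
  obtains \<sigma> where "\<sigma> \<in> {1, -1}" "\<And>s. s \<in> S \<Longrightarrow> f s = \<sigma>"
proof -
  have "finite (f ` S)"
    using f by (intro finite_subset[of "f ` S" "{1, -1}"]) auto
  then have "f constant_on S"
    using continuous_finite_range_constant assms by blast
  then obtain c where c: "\<And>s. s \<in> S \<Longrightarrow> f s = c"
    by (auto simp: constant_on_def)
  show ?thesis
  proof (cases "S = {}")
    case True
    then show ?thesis
      by (intro that[of 1]) auto
  next
    case False
    then show ?thesis
      using c f by (intro that[of c]) auto
  qed
qed

text \<open>Taking norms gives \<open>\<bar>a\<bar> = \<bar>b\<bar>\<close>, so the vectors agree up
  to sign. Writing that sign as \<open>u \<bullet> w\<close> makes it a continuous function of the
  parameter when \<open>u\<close> and \<open>w\<close> are continuous fields.\<close>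

lemma parallel_unit_vectors:
  fixes u w :: "'a::real_inner"
  assumes "norm u = 1" "norm w = 1" "a *\<^sub>R u = b *\<^sub>R w" "a \<noteq> 0"
  shows "u \<bullet> w \<in> {1, -1} \<and> u = (u \<bullet> w) *\<^sub>R w"
proof -
  have "norm (a *\<^sub>R u) = norm (b *\<^sub>R w)"
    using assms(3) by simp
  then have "\<bar>a\<bar> = \<bar>b\<bar>"
    using assms(1,2) by simp
  then have ba: "b / a \<in> {1, -1}"
    using \<open>a \<noteq> 0\<close> by (auto simp: abs_if split: if_splits)
  have u: "u = (b / a) *\<^sub>R w"
    using assms(3,4) by (metis divideR_right scaleR_scaleR divide_inverse_commute)
  have "u \<bullet> w = b / a"
    using assms(2) by (subst u) (simp add: dot_square_norm)
  then show ?thesis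
    using ba u by metis
qed

text \<open>The curve alone determines \<open>T\<close>. Its derivative fixes the line of
  \<open>N1\<close>, because \<open>\<kappa>1\<close> does not vanish, and the derivative of
  \<open>N1\<close> then fixes the line of \<open>N2\<close>, because \<open>\<kappa>2\<close> does
  not vanish. The remaining signs are inner products of continuous fields, hence constant.\<close>

lemma frenet_curvatures_unique_up_to_sign:
  assumes "open I" "is_interval I"
    and F: "frenet_frame_on I y T N1 N2 \<kappa>1 \<kappa>2"
    and F': "frenet_frame_on I y T' N1' N2' \<kappa>1' \<kappa>2'"
    and k1: "\<And>s. s \<in> I \<Longrightarrow> \<kappa>1 s \<noteq> 0" and k2: "\<And>s. s \<in> I \<Longrightarrow> \<kappa>2 s \<noteq> 0"
  shows "\<exists>\<sigma>1\<in>{1, -1}. \<exists>\<sigma>2\<in>{1, -1}. \<forall>s\<in>I. \<kappa>1' s = \<sigma>1 * \<kappa>1 s \<and> \<kappa>2' s = \<sigma>2 * \<kappa>2 s"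
proof -
  have con: "connected I"
    using assms(2) is_interval_connected by blast
  note D = F[unfolded frenet_frame_on_def] F'[unfolded frenet_frame_on_def]
  have v: "speed y s \<noteq> 0" if "s \<in> I" for s
    using D(1) that by (auto simp: speed_def regular_curve_on_def)
  have TT: "T' s = T s" if "s \<in> I" for s
    using D that by metis
  have unit: "norm (N1 s) = 1" "norm (N2 s) = 1" "norm (N1' s) = 1" "norm (N2' s) = 1"
    if "s \<in> I" for s
    using D that by (auto simp: orthonormal_frame_def)
  have cont: "continuous_on I N1" "continuous_on I N2" "continuous_on I N1'" "continuous_on I N2'"
    using D by (blast intro: continuous_at_imp_continuous_on has_vector_derivative_continuous)+
  have e1: "\<kappa>1 s *\<^sub>R N1 s = \<kappa>1' s *\<^sub>R N1' s" if s: "s \<in> I" for s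
  proof -
    \<comment> \<open>\<open>T\<close> and \<open>T'\<close> are known to agree only on
      \<open>I\<close>; openness of \<open>I\<close> transfers the derivative.\<close>
    have "(T has_vector_derivative (speed y s * \<kappa>1' s) *\<^sub>R N1' s) (at s)"
      using D(2) s TT \<open>open I\<close>
      by (intro has_vector_derivative_transform_within_open[of T' _ s I T]) auto
    then have "(speed y s * \<kappa>1 s) *\<^sub>R N1 s = (speed y s * \<kappa>1' s) *\<^sub>R N1' s"
      using D(1) s vector_derivative_unique_at by blast
    then show ?thesis
      using v[OF s] by (metis scaleR_scaleR scaleR_left_imp_eq)
  qed
  have "N1 s \<bullet> N1' s \<in> {1, -1}" if "s \<in> I" for s
    using parallel_unit_vectors e1 unit k1 that by blast
  then obtain \<tau> where t: "\<tau> \<in> {1, -1}" and "\<And>s. s \<in> I \<Longrightarrow> N1 s \<bullet> N1' s = \<tau>"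
    using continuous_sign_constant[OF con, of "\<lambda>s. N1 s \<bullet> N1' s"] cont
    by (auto simp: continuous_on_inner)
  then have N1: "N1 s = \<tau> *\<^sub>R N1' s" if "s \<in> I" for s
    using parallel_unit_vectors e1 unit k1 that by metis
  have K1: "\<kappa>1' s = \<tau> * \<kappa>1 s" if s: "s \<in> I" for s
  proof -
    have "(\<kappa>1 s * \<tau>) *\<^sub>R N1' s = \<kappa>1' s *\<^sub>R N1' s"
      using e1[OF s] N1[OF s] by simp
    then show ?thesis
      using unit(3)[OF s] by (auto simp: mult.commute)
  qed
  \<comment> \<open>Differentiating \<open>N1 = \<tau> N1'\<close> gives two expansions of one
    vector. Their tangential parts agree since \<open>\<tau>\<close> is its own inverse, which
    leaves the \<open>N2\<close> parts.\<close>
  have e2: "\<kappa>2 s *\<^sub>R N2 s = (\<tau> * \<kappa>2' s) *\<^sub>R N2' s" if s: "s \<in> I" for s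
  proof -
    have "((\<lambda>s. \<tau> *\<^sub>R N1' s) has_vector_derivative
        \<tau> *\<^sub>R (speed y s *\<^sub>R (- \<kappa>1' s *\<^sub>R T' s + \<kappa>2' s *\<^sub>R N2' s))) (at s)"
      using D(2) s by (intro bounded_linear.has_vector_derivative[OF bounded_linear_scaleR_right]) auto
    then have "(N1 has_vector_derivative
        \<tau> *\<^sub>R (speed y s *\<^sub>R (- \<kappa>1' s *\<^sub>R T' s + \<kappa>2' s *\<^sub>R N2' s))) (at s)"
      by (rule has_vector_derivative_transform_within_open[OF _ \<open>open I\<close> s]) (simp add: N1)
    moreover have "(N1 has_vector_derivative
        speed y s *\<^sub>R (- \<kappa>1 s *\<^sub>R T s + \<kappa>2 s *\<^sub>R N2 s)) (at s)"
      using D(1) s by auto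
    ultimately have "speed y s *\<^sub>R (- \<kappa>1 s *\<^sub>R T s + \<kappa>2 s *\<^sub>R N2 s) =
        speed y s *\<^sub>R (\<tau> *\<^sub>R (- \<kappa>1' s *\<^sub>R T' s + \<kappa>2' s *\<^sub>R N2' s))"
      using vector_derivative_unique_at by (metis scaleR_left_commute)
    then have "- \<kappa>1 s *\<^sub>R T s + \<kappa>2 s *\<^sub>R N2 s =
        \<tau> *\<^sub>R (- \<kappa>1' s *\<^sub>R T' s + \<kappa>2' s *\<^sub>R N2' s)"
      using v[OF s] scaleR_left_imp_eq by blast
    moreover have "\<tau> * \<kappa>1' s = \<kappa>1 s"
      using K1[OF s] t by auto
    ultimately show ?thesis
      by (simp add: TT[OF s] scaleR_right_distrib scaleR_right_diff_distrib)
  qed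
  have "N2 s \<bullet> N2' s \<in> {1, -1}" if "s \<in> I" for s
    using parallel_unit_vectors e2 unit k2 that by blast
  then obtain \<omega> where w: "\<omega> \<in> {1, -1}" and "\<And>s. s \<in> I \<Longrightarrow> N2 s \<bullet> N2' s = \<omega>"
    using continuous_sign_constant[OF con, of "\<lambda>s. N2 s \<bullet> N2' s"] cont
    by (auto simp: continuous_on_inner)
  then have N2: "N2 s = \<omega> *\<^sub>R N2' s" if "s \<in> I" for s
    using parallel_unit_vectors e2 unit k2 that by metis
  \<comment> \<open>Both normals may flip, and the second curvature couples them, so its sign is the
    product of the two flips.\<close>
  have K2: "\<kappa>2' s = (\<tau> * \<omega>) * \<kappa>2 s" if s: "s \<in> I" for s
  proof -
    have "(\<kappa>2 s * \<omega>) *\<^sub>R N2' s = (\<tau> * \<kappa>2' s) *\<^sub>R N2' s"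
      using e2[OF s] N2[OF s] by simp
    then have "\<kappa>2 s * \<omega> = \<tau> * \<kappa>2' s"
      using unit(4)[OF s] by auto
    then show ?thesis
      using t w by auto
  qed
  show ?thesis
    using t w K1 K2 by (intro bexI[of _ \<tau>] bexI[of _ "\<tau> * \<omega>"]) auto
qed

section \<open>Velocity and Frenet frame of the evolute\<close>

text \<open>
  The frame is orthonormal, so \<open>\<rho>\<close> and \<open>\<rho>' / \<kappa>2\<close> are the components of \<open>evolute - x\<close> along \<open>N1\<close>
  and \<open>N2\<close>; this makes them differentiable without any smoothness assumption on the curvatures.
\<close>

lemma evolute_has_vector_derivative:
  assumes "open I"
    and arc: "arclength_parametrized_on I x"
    and F: "frenet_frame_on I x T N1 N2 \<kappa>1 \<kappa>2"
    and k1: "\<And>s. s \<in> I \<Longrightarrow> \<kappa>1 s \<noteq> 0" and k2: "\<And>s. s \<in> I \<Longrightarrow> \<kappa>2 s \<noteq> 0"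
    and \<rho>: "\<rho> = curvature_radius \<kappa>1"
    and reg: "regular_curve_on I (evolute x N1 N2 \<kappa>1 \<kappa>2)"
    and s: "s \<in> I"
  shows "(evolute x N1 N2 \<kappa>1 \<kappa>2 has_vector_derivative
           (\<rho> s * \<kappa>2 s + deriv (\<lambda>t. deriv \<rho> t / \<kappa>2 t) s) *\<^sub>R N2 s) (at s)"
proof -
  define c where "c = (\<lambda>t. deriv \<rho> t / \<kappa>2 t)"
  define y where "y = evolute x N1 N2 \<kappa>1 \<kappa>2"
  note D = F[unfolded frenet_frame_on_def]
  have y: "y = (\<lambda>t. x t + \<rho> t *\<^sub>R N1 t + c t *\<^sub>R N2 t)"
    by (auto simp: y_def evolute_def c_def \<rho>)
  have v: "speed x s = 1"
    using arc s by (auto simp: arclength_parametrized_on_def)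
  have xd: "(x has_vector_derivative T s) (at s)"
    using D arc s v vector_derivative_works[of x "at s"]
    by (auto simp: arclength_parametrized_on_def)
  have N1d: "(N1 has_vector_derivative (- \<kappa>1 s *\<^sub>R T s + \<kappa>2 s *\<^sub>R N2 s)) (at s)"
    using D s v by (metis scaleR_one)
  have N2d: "(N2 has_vector_derivative - \<kappa>2 s *\<^sub>R N1 s) (at s)"
    using D s v by (metis mult_1)
  have diff: "x differentiable at s" "N1 differentiable at s" "N2 differentiable at s"
    "y differentiable at s"
    using xd N1d N2d reg s by (auto simp: regular_curve_on_def y_def intro: differentiableI_vector)
  have orth: "N1 t \<bullet> N1 t = 1" "N2 t \<bullet> N2 t = 1" "N1 t \<bullet> N2 t = 0" if "t \<in> I" for t
    using D that by (auto simp: orthonormal_frame_def dot_square_norm)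
  \<comment> \<open>The inner products below equal \<open>\<rho>\<close> and \<open>c\<close> only
    on \<open>I\<close>, where the frame is orthonormal; since \<open>I\<close> is open,
    differentiability at \<open>s\<close> carries over.\<close>
  have transform: "g differentiable at s"
    if "f differentiable at s" "\<And>t. t \<in> I \<Longrightarrow> f t = g t" for f g :: "real \<Rightarrow> real"
    using that s \<open>open I\<close> unfolding differentiable_def
    by (blast intro: has_derivative_transform_within_open)
  have "(\<lambda>t. (y t - x t) \<bullet> N1 t) differentiable at s"
    using diff by auto
  then have "\<rho> differentiable at s"
    by (rule transform[of "\<lambda>t. (y t - x t) \<bullet> N1 t"]) (simp add: y inner_add_left inner_add_right inner_commute orth)
  then have rd: "(\<rho> has_vector_derivative deriv \<rho> s) (at s)"
    using DERIV_deriv_iff_real_differentiable has_real_derivative_iff_has_vector_derivative by blast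
  have "(\<lambda>t. (y t - x t) \<bullet> N2 t) differentiable at s"
    using diff by auto
  then have "c differentiable at s"
    by (rule transform[of "\<lambda>t. (y t - x t) \<bullet> N2 t"]) (simp add: y inner_add_left inner_add_right inner_commute orth)
  then have cd: "(c has_vector_derivative deriv c s) (at s)"
    using DERIV_deriv_iff_real_differentiable has_real_derivative_iff_has_vector_derivative by blast
  have "(y has_vector_derivative
      T s + (\<rho> s *\<^sub>R (- \<kappa>1 s *\<^sub>R T s + \<kappa>2 s *\<^sub>R N2 s) + deriv \<rho> s *\<^sub>R N1 s)
        + (c s *\<^sub>R (- \<kappa>2 s *\<^sub>R N1 s) + deriv c s *\<^sub>R N2 s)) (at s)"
    unfolding y
    using xd N1d N2d rd cd
    by (intro has_vector_derivative_add has_vector_derivative_scaleR)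
      (auto simp: has_real_derivative_iff_has_vector_derivative)
  \<comment> \<open>The first relation cancels the \<open>T\<close> components, the second the
    \<open>N1\<close> components. Only the \<open>N2\<close> component survives.\<close>
  moreover have "\<rho> s * \<kappa>1 s = 1" "c s * \<kappa>2 s = deriv \<rho> s"
    using k1 k2 s by (auto simp: \<rho> curvature_radius_def c_def)
  ultimately show ?thesis
    unfolding y_def[symmetric] c_def[symmetric] by (simp add: algebra_simps)
qed

text \<open>The velocity \<open>g *\<^sub>R N2\<close> makes \<open>N2\<close> the tangent line of
  the evolute. The Frenet equations of \<open>x\<close>, read in reverse order, then become those of
  the evolute after dividing by its speed \<open>\<bar>g\<bar>\<close>. Regularity of the evolute
  forces \<open>g\<close>, and so \<open>q\<close>, to be nonzero.\<close>

lemma frenet_frame_on_evolute: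
  assumes "open I" "is_interval I"
    and arc: "arclength_parametrized_on I x"
    and F: "frenet_frame_on I x T N1 N2 \<kappa>1 \<kappa>2"
    and k1: "\<And>s. s \<in> I \<Longrightarrow> \<kappa>1 s \<noteq> 0" and k2: "\<And>s. s \<in> I \<Longrightarrow> \<kappa>2 s \<noteq> 0"
    and \<rho>: "\<rho> = curvature_radius \<kappa>1"
    and reg: "regular_curve_on I (evolute x N1 N2 \<kappa>1 \<kappa>2)"
  defines "q \<equiv> \<lambda>s. \<rho> s * (\<kappa>2 s)\<^sup>2 + \<kappa>2 s * deriv (\<lambda>t. deriv \<rho> t / \<kappa>2 t) s"
  shows "\<exists>T' N1' N2'. frenet_frame_on I (evolute x N1 N2 \<kappa>1 \<kappa>2) T' N1' N2'
            (\<lambda>s. (\<kappa>2 s)\<^sup>2 / \<bar>q s\<bar>) (\<lambda>s. \<kappa>1 s * \<kappa>2 s / \<bar>q s\<bar>)"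
    and "\<And>s. s \<in> I \<Longrightarrow> q s \<noteq> 0"
proof -
  define y where "y = evolute x N1 N2 \<kappa>1 \<kappa>2"
  define g where "g = (\<lambda>s. \<rho> s * \<kappa>2 s + deriv (\<lambda>t. deriv \<rho> t / \<kappa>2 t) s)"
  note D = F[unfolded frenet_frame_on_def]
  \<comment> \<open>This gives \<open>\<bar>q s\<bar>\<close> as
    \<open>\<bar>\<kappa>2 s\<bar>\<close> times the speed of the evolute, which ties the
    denominators to the geometry.\<close>
  have q: "q s = \<kappa>2 s * g s" for s
    by (simp add: q_def g_def algebra_simps power2_eq_square)
  have yd: "(y has_vector_derivative g s *\<^sub>R N2 s) (at s)" if "s \<in> I" for s
    unfolding y_def g_def using evolute_has_vector_derivative[OF assms(1) arc F k1 k2 \<rho> reg that] .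
  have vd: "vector_derivative y (at s) = g s *\<^sub>R N2 s" if "s \<in> I" for s
    using yd[OF that] by (rule vector_derivative_at)
  have g0: "g s \<noteq> 0" if "s \<in> I" for s
    using reg vd[OF that] that by (auto simp: regular_curve_on_def y_def)
  then show q0: "q s \<noteq> 0" if "s \<in> I" for s
    using k2 q that by simp
  have v: "speed x s = 1" if "s \<in> I" for s
    using arc that by (auto simp: arclength_parametrized_on_def)
  have orth: "orthonormal_frame (T s) (N1 s) (N2 s)" if "s \<in> I" for s
    using D that by auto
  then have vy: "speed y s = \<bar>g s\<bar>" if "s \<in> I" for s
    using vd that by (simp add: speed_def orthonormal_frame_def)
  have Td: "(T has_vector_derivative \<kappa>1 s *\<^sub>R N1 s) (at s)" if "s \<in> I" for s
    using D v that by (metis mult_1)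
  have N1d: "(N1 has_vector_derivative (- \<kappa>1 s *\<^sub>R T s + \<kappa>2 s *\<^sub>R N2 s)) (at s)" if "s \<in> I" for s
    using D v that by (metis scaleR_one)
  have N2d: "(N2 has_vector_derivative - \<kappa>2 s *\<^sub>R N1 s) (at s)" if "s \<in> I" for s
    using D v that by (metis mult_1)
  have cont: "continuous_on I N1" "continuous_on I N2"
    using N1d N2d by (blast intro: continuous_at_imp_continuous_on has_vector_derivative_continuous)+
  have nz: "N1 s \<noteq> 0" "N2 s \<noteq> 0" if "s \<in> I" for s
    using orth[OF that] by (auto simp: orthonormal_frame_def)
  have sg: "sgn (g a) = sgn (g b)" if "a \<in> I" "b \<in> I" for a b
    by (rule velocity_coefficient_sgn_eq[OF assms(1,2) yd cont(2) nz(2) g0 that])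
  \<comment> \<open>Here \<open>N2\<close> itself plays the role of the curve: its velocity is
    \<open>- \<kappa>2\<close> times the unit field \<open>N1\<close>.\<close>
  have nk: "sgn (- \<kappa>2 a) = sgn (- \<kappa>2 b)" if "a \<in> I" "b \<in> I" for a b
    by (rule velocity_coefficient_sgn_eq[OF assms(1,2) N2d cont(1) nz(1) _ that]) (use k2 in auto)
  have sk: "sgn (\<kappa>2 a) = sgn (\<kappa>2 b)" if "a \<in> I" "b \<in> I" for a b
    using nk[OF that] by (simp add: sgn_minus)
  \<comment> \<open>The signs of \<open>g\<close> and \<open>\<kappa>2\<close> are read off at one
    base point, or set to 1 if \<open>I\<close> is empty. Being constants, they can be pulled out of
    derivatives of the frame.\<close>
  obtain \<epsilon> \<delta> :: real where
    e: "\<epsilon> \<in> {1, -1}" "\<And>s. s \<in> I \<Longrightarrow> g s = \<epsilon> * \<bar>g s\<bar>" and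
    d: "\<delta> \<in> {1, -1}" "\<And>s. s \<in> I \<Longrightarrow> \<kappa>2 s = \<delta> * \<bar>\<kappa>2 s\<bar>"
  proof (cases "I = {}")
    case True
    then show ?thesis
      by (intro that[of 1 1]) auto
  next
    case False
    then obtain a where a: "a \<in> I"
      by auto
    show ?thesis
    proof (rule that[of "sgn (g a)" "sgn (\<kappa>2 a)"])
      show "g s = sgn (g a) * \<bar>g s\<bar>" "\<kappa>2 s = sgn (\<kappa>2 a) * \<bar>\<kappa>2 s\<bar>" if "s \<in> I" for s
        using sg[OF a that] sk[OF a that] by (metis sgn_mult_abs)+
    qed (use g0[OF a] k2[OF a] in \<open>auto simp: sgn_if\<close>)
  qed
  \<comment> \<open>The tangent must carry \<open>\<epsilon>\<close>, the sign of \<open>g\<close>.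
    The factor \<open>- \<epsilon> * \<delta>\<close> on \<open>N1\<close> makes the first curvature
    positive, and \<open>\<epsilon>\<close> on \<open>T\<close> gives the second one the sign of
    \<open>\<kappa>1 * \<kappa>2\<close>.\<close>
  have "frenet_frame_on I y (\<lambda>s. \<epsilon> *\<^sub>R N2 s) (\<lambda>s. (- \<epsilon> * \<delta>) *\<^sub>R N1 s) (\<lambda>s. \<epsilon> *\<^sub>R T s)
            (\<lambda>s. (\<kappa>2 s)\<^sup>2 / \<bar>q s\<bar>) (\<lambda>s. \<kappa>1 s * \<kappa>2 s / \<bar>q s\<bar>)"
    unfolding frenet_frame_on_def
  proof (intro conjI ballI)
    show "regular_curve_on I y"
      using reg by (simp add: y_def)
    fix s assume s: "s \<in> I"
    have ab: "\<bar>\<epsilon>\<bar> = 1" "\<bar>\<delta>\<bar> = 1" "\<epsilon> * \<epsilon> = 1" "\<delta> * \<delta> = 1"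
      using e(1) d(1) by auto
    show "orthonormal_frame (\<epsilon> *\<^sub>R N2 s) ((- \<epsilon> * \<delta>) *\<^sub>R N1 s) (\<epsilon> *\<^sub>R T s)"
      using orth[OF s] ab by (simp add: orthonormal_frame_def inner_commute abs_mult)
    have "g s / \<bar>g s\<bar> = \<epsilon>"
      using e(2)[OF s] g0[OF s] by (simp add: divide_eq_eq)
    then show "\<epsilon> *\<^sub>R N2 s = vector_derivative y (at s) /\<^sub>R speed y s"
      using vd[OF s] vy[OF s] by (simp add: field_simps)
    \<comment> \<open>The speed \<open>\<bar>g s\<bar>\<close> cancels against
      \<open>\<bar>q s\<bar>\<close>, leaving \<open>\<bar>\<kappa>2 s\<bar>\<close>, which is
      \<open>\<delta> * \<kappa>2 s\<close>.\<close>
    have K1: "speed y s * ((\<kappa>2 s)\<^sup>2 / \<bar>q s\<bar>) = \<delta> * \<kappa>2 s"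
      using vy[OF s] g0[OF s] k2[OF s] d(2)[OF s] ab
      by (simp add: q abs_mult power2_eq_square field_simps)
    have K2: "speed y s * (\<kappa>1 s * \<kappa>2 s / \<bar>q s\<bar>) = \<delta> * \<kappa>1 s"
      using vy[OF s] g0[OF s] k2[OF s] d(2)[OF s]
      by (simp add: q abs_mult field_simps)
    have "((\<lambda>s. \<epsilon> *\<^sub>R N2 s) has_vector_derivative \<epsilon> *\<^sub>R (- \<kappa>2 s *\<^sub>R N1 s)) (at s)"
      by (intro bounded_linear.has_vector_derivative[OF bounded_linear_scaleR_right] N2d s)
    then show "((\<lambda>s. \<epsilon> *\<^sub>R N2 s) has_vector_derivative
        (speed y s * ((\<kappa>2 s)\<^sup>2 / \<bar>q s\<bar>)) *\<^sub>R ((- \<epsilon> * \<delta>) *\<^sub>R N1 s)) (at s)"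
      unfolding K1 using d(1) by (auto simp: mult.commute)
    have "((\<lambda>s. (- \<epsilon> * \<delta>) *\<^sub>R N1 s) has_vector_derivative
        (- \<epsilon> * \<delta>) *\<^sub>R (- \<kappa>1 s *\<^sub>R T s + \<kappa>2 s *\<^sub>R N2 s)) (at s)"
      by (intro bounded_linear.has_vector_derivative[OF bounded_linear_scaleR_right] N1d s)
    moreover have "(- \<epsilon> * \<delta>) *\<^sub>R (- \<kappa>1 s *\<^sub>R T s + \<kappa>2 s *\<^sub>R N2 s) =
        - (\<delta> * \<kappa>2 s) *\<^sub>R (\<epsilon> *\<^sub>R N2 s) + (\<delta> * \<kappa>1 s) *\<^sub>R (\<epsilon> *\<^sub>R T s)"
      by (simp add: algebra_simps)
    ultimately show "((\<lambda>s. (- \<epsilon> * \<delta>) *\<^sub>R N1 s) has_vector_derivative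
        speed y s *\<^sub>R (- ((\<kappa>2 s)\<^sup>2 / \<bar>q s\<bar>) *\<^sub>R (\<epsilon> *\<^sub>R N2 s)
          + (\<kappa>1 s * \<kappa>2 s / \<bar>q s\<bar>) *\<^sub>R (\<epsilon> *\<^sub>R T s))) (at s)"
      unfolding scaleR_add_right scaleR_scaleR[of "speed y s"] mult_minus_right K1 K2 by simp
    have "((\<lambda>s. \<epsilon> *\<^sub>R T s) has_vector_derivative \<epsilon> *\<^sub>R (\<kappa>1 s *\<^sub>R N1 s)) (at s)"
      by (intro bounded_linear.has_vector_derivative[OF bounded_linear_scaleR_right] Td s)
    then show "((\<lambda>s. \<epsilon> *\<^sub>R T s) has_vector_derivative
        - (speed y s * (\<kappa>1 s * \<kappa>2 s / \<bar>q s\<bar>)) *\<^sub>R ((- \<epsilon> * \<delta>) *\<^sub>R N1 s)) (at s)"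
      unfolding K2 using d(1) by (auto simp: mult.commute)
  qed
  then show "\<exists>T' N1' N2'. frenet_frame_on I (evolute x N1 N2 \<kappa>1 \<kappa>2) T' N1' N2'
            (\<lambda>s. (\<kappa>2 s)\<^sup>2 / \<bar>q s\<bar>) (\<lambda>s. \<kappa>1 s * \<kappa>2 s / \<bar>q s\<bar>)"
    unfolding y_def by blast
qed

section \<open>Curvatures of the evolute\<close>

text \<open>Frenet frames carry no orientation or sign convention, so curvatures are meaningful only
  up to constant signs; hence the formulas are first realized by some frame and then compared with
  every other one. Regularity of the evolute is what lets it have a Frenet frame.\<close>

theorem proposition20:
  fixes x T N1 N2 :: "real \<Rightarrow> real^3" and \<kappa>1 \<kappa>2 \<rho> :: "real \<Rightarrow> real" and I :: "real set"
  assumes "open I" and "is_interval I"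
    and "arclength_parametrized_on I x"
    and "frenet_frame_on I x T N1 N2 \<kappa>1 \<kappa>2"
    and "\<And>s. s \<in> I \<Longrightarrow> \<kappa>1 s \<noteq> 0" and "\<And>s. s \<in> I \<Longrightarrow> \<kappa>2 s \<noteq> 0"
    and "\<rho> = curvature_radius \<kappa>1"
    and "regular_curve_on I (evolute x N1 N2 \<kappa>1 \<kappa>2)"
  shows "(\<exists>T' N1' N2'. frenet_frame_on I (evolute x N1 N2 \<kappa>1 \<kappa>2) T' N1' N2'
            (\<lambda>s. (\<kappa>2 s)\<^sup>2 / \<bar>\<rho> s * (\<kappa>2 s)\<^sup>2 + \<kappa>2 s * deriv (\<lambda>t. deriv \<rho> t / \<kappa>2 t) s\<bar>)
            (\<lambda>s. \<kappa>1 s * \<kappa>2 s / \<bar>\<rho> s * (\<kappa>2 s)\<^sup>2 + \<kappa>2 s * deriv (\<lambda>t. deriv \<rho> t / \<kappa>2 t) s\<bar>))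
       \<and> (\<forall>T' N1' N2' k1 k2. frenet_frame_on I (evolute x N1 N2 \<kappa>1 \<kappa>2) T' N1' N2' k1 k2 \<longrightarrow>
            (\<exists>\<sigma>1\<in>{1, -1}. \<exists>\<sigma>2\<in>{1, -1}. \<forall>s\<in>I.
               k1 s = \<sigma>1 * ((\<kappa>2 s)\<^sup>2 / \<bar>\<rho> s * (\<kappa>2 s)\<^sup>2 + \<kappa>2 s * deriv (\<lambda>t. deriv \<rho> t / \<kappa>2 t) s\<bar>)
             \<and> k2 s = \<sigma>2 * (\<kappa>1 s * \<kappa>2 s / \<bar>\<rho> s * (\<kappa>2 s)\<^sup>2 + \<kappa>2 s * deriv (\<lambda>t. deriv \<rho> t / \<kappa>2 t) s\<bar>)))"
proof -
  note evolute_frame = frenet_frame_on_evolute[OF assms]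
  obtain T' N1' N2' where F: "frenet_frame_on I (evolute x N1 N2 \<kappa>1 \<kappa>2) T' N1' N2'
      (\<lambda>s. (\<kappa>2 s)\<^sup>2 / \<bar>\<rho> s * (\<kappa>2 s)\<^sup>2 + \<kappa>2 s * deriv (\<lambda>t. deriv \<rho> t / \<kappa>2 t) s\<bar>)
      (\<lambda>s. \<kappa>1 s * \<kappa>2 s / \<bar>\<rho> s * (\<kappa>2 s)\<^sup>2 + \<kappa>2 s * deriv (\<lambda>t. deriv \<rho> t / \<kappa>2 t) s\<bar>)"
    using evolute_frame(1) by blast
  show ?thesis
  proof (intro conjI allI impI)
    fix T'' N1'' N2'' k1 k2
    assume G: "frenet_frame_on I (evolute x N1 N2 \<kappa>1 \<kappa>2) T'' N1'' N2'' k1 k2"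
    \<comment> \<open>The frame \<open>F\<close> serves as reference: its two curvatures vanish
      nowhere on \<open>I\<close>, because \<open>\<kappa>1\<close>, \<open>\<kappa>2\<close> and
      the denominator do not.\<close>
    show "\<exists>\<sigma>1\<in>{1, -1}. \<exists>\<sigma>2\<in>{1, -1}. \<forall>s\<in>I.
        k1 s = \<sigma>1 * ((\<kappa>2 s)\<^sup>2 / \<bar>\<rho> s * (\<kappa>2 s)\<^sup>2 + \<kappa>2 s * deriv (\<lambda>t. deriv \<rho> t / \<kappa>2 t) s\<bar>)
      \<and> k2 s = \<sigma>2 * (\<kappa>1 s * \<kappa>2 s / \<bar>\<rho> s * (\<kappa>2 s)\<^sup>2 + \<kappa>2 s * deriv (\<lambda>t. deriv \<rho> t / \<kappa>2 t) s\<bar>)"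
      by (rule frenet_curvatures_unique_up_to_sign[OF assms(1,2) F G])
        (use assms(5,6) evolute_frame(2) in auto)
  qed (use F in blast)
qed

end
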